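(* Let $K\in\mathcal{K}^2$ and let $\lambda_i=\lambda_i(K)$, $i=1,2$, be its successive minima. Then $$\mathrm{G}(K)\leq\mathrm{vol}(K)\left(1+\frac{\lambda_1}{2}\right)\left(1+\lambda_2\right)$$ and $$\mathrm{G}(\mathrm{int}\,K)\geq\mathrm{vol}(K)\left(1-\frac{\lambda_1}{2}-\lambda_2\right).$$
   Context: $\mathcal{K}^2$ is the class of all compact convex sets in $\mathbb{R}^2$ with non-empty interior. For $A\subseteq\mathbb{R}^2$, $\mathrm{G}(A)=|A\cap\mathbb{Z}^2|$ is the number of integer points in $A$; $\mathrm{vol}$ is the area and $\mathrm{int}$ denotes the interior. For $K\in\mathcal{K}^2$ with $K=-K$, the $i$-th successive minimum is $\lambda_i(K)=\min\{\lambda>0:\dim(\lambda K\cap\mathbb{Z}^2)\geq i\}$, $i=1,2$, where $\dim$ of a set of lattice points in the symmetric body is the dimension of its linear span. For general $K\in\mathcal{K}^2$ one puts $\lambda_i(K)=\lambda_i(\mathrm{cs}(K))$, where $\mathrm{cs}(K)=\frac12(K-K)$. *)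

theory Defs
  imports "HOL-Analysis.Analysis"
begin

definition convex_bodies :: "(real ^ 2) set set" where
  "convex_bodies = {K. compact K \<and> convex K \<and> interior K \<noteq> {}}"

definition integer_lattice :: "(real ^ 2) set" where
  "integer_lattice = {x. \<forall>i. x $ i \<in> \<int>}"

definition lattice_count :: "(real ^ 2) set \<Rightarrow> nat" where
  "lattice_count A = card (A \<inter> integer_lattice)"

definition central_sym :: "(real ^ 2) set \<Rightarrow> (real ^ 2) set" where
  "central_sym K = {(1/2) *\<^sub>R (x - y) | x y. x \<in> K \<and> y \<in> K}"

text \<open>Intended for origin-symmetric convex bodies and \<open>i \<in> {1, 2}\<close>, where the minimum exists.\<close>

definition successive_min_sym :: "nat \<Rightarrow> (real ^ 2) set \<Rightarrow> real" where
  "successive_min_sym i K =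
     (LEAST l. 0 < l \<and> i \<le> dim (((\<lambda>x. l *\<^sub>R x) ` K) \<inter> integer_lattice))"

text \<open>For \<open>K = - K\<close> convex, \<open>central_sym K = K\<close>, so this agrees with the symmetric notion.\<close>

definition successive_min :: "nat \<Rightarrow> (real ^ 2) set \<Rightarrow> real" where
  "successive_min i K = successive_min_sym i (central_sym K)"

end

theory Submission
  imports Defs
begin

text \<open>Choose a basis \<open>u\<close>, \<open>v\<close> of \<open>\<int>\<^sup>2\<close> with \<open>u \<in> \<lambda>\<^sub>1 cs(K)\<close> and \<open>v \<in> \<lambda>\<^sub>2 cs(K)\<close>, and use it as
  coordinate system. Let \<open>g(x)\<close> be the length of the vertical chord of \<open>K\<close> at abscissa \<open>x\<close>, a concave
  function on an interval of length \<open>w\<close> with maximum \<open>M\<close> and integral \<open>V = vol(K)\<close>. Then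
  \<open>w \<ge> L = 2 / \<lambda>\<^sub>1 \<ge> M \<ge> 2 / \<lambda>\<^sub>2\<close>, and the grid line at \<open>x\<close> carries at most \<open>g(x) + 1\<close> points of \<open>K\<close>
  and at least \<open>g(x) - 1\<close> points of its interior. Sums of \<open>g\<close> over the integers are compared with
  \<open>V\<close> by the trapezoid rule (upper bound) and the midpoint rule (lower bound). The boundary errors
  and the number of grid lines are absorbed by \<open>M w \<le> 2 V\<close> and by the sharper
  \<open>M (y - x) + s w \<le> 2 V\<close>, valid whenever \<open>x \<le> y\<close> and \<open>s \<le> min (g x) (g y)\<close>.\<close>

section \<open>Concave functions and sums over the integers\<close>

lemma integral_affine:
  fixes a b k l :: real
  assumes "a \<le> b"
  shows "((\<lambda>x. k + l * x) has_integral (b - a) * (k + l * (a + b) / 2)) {a..b}"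
proof -
  have "((\<lambda>x. k + l * x) has_integral (b - a) * k + l * ((b\<^sup>2 - a\<^sup>2) / 2)) {a..b}"
    using assms has_integral_const_real[of k a b]
    by (intro has_integral_add has_integral_mult_right ident_has_integral) auto
  moreover have "(b - a) * k + l * ((b\<^sup>2 - a\<^sup>2) / 2) = (b - a) * (k + l * (a + b) / 2)"
    by (simp add: field_simps power2_eq_square)
  ultimately show ?thesis by simp
qed

text \<open>Abstract form of the chord-length function. \<open>wide\<close> says that no vertical
  chord is longer than the horizontal extent; \<open>area_ratio\<close> uses it to trade width
  against height.\<close>

locale concave_profile =
  fixes g :: "real \<Rightarrow> real" and c d m :: real
  assumes concave: "concave_on {c..d} g"
    and nonneg: "\<And>x. x \<in> {c..d} \<Longrightarrow> 0 \<le> g x"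
    and peak_in: "m \<in> {c..d}"
    and peak: "\<And>x. x \<in> {c..d} \<Longrightarrow> g x \<le> g m"
    and peak_pos: "0 < g m"
    and wide: "g m \<le> d - c"
    and integrable: "g integrable_on {c..d}"
begin

abbreviation I :: "real \<Rightarrow> real \<Rightarrow> real" where "I a b \<equiv> integral {a..b} g"

text \<open>The hypotheses are symmetric under reversal of the axis. This reduces
  \<open>lower_cut\<close> to the orientation in which the left cut has the smaller height.\<close>

lemma reflect: "concave_profile (\<lambda>x. g (- x)) (- d) (- c) (- m)"
proof
  show "concave_on {- d..- c} (\<lambda>x. g (- x))"
    unfolding concave_on_iff
  proof (intro conjI ballI allI impI)
    fix x y u v :: real
    assume "x \<in> {- d..- c}" "y \<in> {- d..- c}" "0 \<le> u" "0 \<le> v" "u + v = 1"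
    moreover from this have "- x \<in> {c..d}" "- y \<in> {c..d}" by auto
    ultimately have "u * g (- x) + v * g (- y) \<le> g (u *\<^sub>R (- x) + v *\<^sub>R (- y))"
      using concave unfolding concave_on_iff by blast
    then show "u * g (- x) + v * g (- y) \<le> g (- (u *\<^sub>R x + v *\<^sub>R y))" by simp
  qed auto
  show "(\<lambda>x. g (- x)) integrable_on {- d..- c}"
    using integrable by (simp add: integrable_reflect_real)
qed (use nonneg peak_in peak peak_pos wide in auto)

section \<open>Integrals over subintervals, the chord inequality and monotonicity\<close>

lemma sub_integrable: "c \<le> a \<Longrightarrow> b \<le> d \<Longrightarrow> g integrable_on {a..b}"
  by (rule integrable_subinterval_real[OF integrable]) auto

lemma I_combine: "c \<le> x \<Longrightarrow> x \<le> y \<Longrightarrow> y \<le> z \<Longrightarrow> z \<le> d \<Longrightarrow> I x z = I x y + I y z"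
  using Henstock_Kurzweil_Integration.integral_combine[of x y z g] sub_integrable by simp

lemma I_le:
  assumes "c \<le> a" "a \<le> b" "b \<le> d" "\<And>x. x \<in> {a..b} \<Longrightarrow> g x \<le> B"
  shows "I a b \<le> (b - a) * B"
proof -
  have "I a b \<le> integral {a..b} (\<lambda>_. B)"
    by (rule integral_le) (use assms sub_integrable in auto)
  then show ?thesis using assms by simp
qed

text \<open>Concavity multiplied through by \<open>z - x\<close>, so that the degenerate case
  \<open>x = z\<close> is included.\<close>

lemma concaveD:
  assumes "x \<in> {c..d}" "z \<in> {c..d}" "x \<le> y" "y \<le> z"
  shows "(z - y) * g x + (y - x) * g z \<le> (z - x) * g y"
proof (cases "x < z")
  case True
  define t where "t = (y - x) / (z - x)"
  have t: "0 \<le> t" "t \<le> 1" "1 - t = (z - y) / (z - x)"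
    using assms True by (auto simp: t_def field_simps)
  have y: "(1 - t) *\<^sub>R x + t *\<^sub>R z = y"
  proof -
    have "(1 - t) *\<^sub>R x + t *\<^sub>R z = x + t * (z - x)" by (simp add: algebra_simps)
    then show ?thesis using True by (simp add: t_def)
  qed
  have "(1 - t) * g x + t * g z \<le> g ((1 - t) *\<^sub>R x + t *\<^sub>R z)"
    using concave assms(1,2) t(1,2) unfolding concave_on_iff by auto
  then have "((z - y) * g x + (y - x) * g z) / (z - x) \<le> g y"
    unfolding y unfolding t(3) by (simp add: t_def add_divide_distrib)
  then show ?thesis using True by (simp add: field_simps)
next
  case False
  with assms have "x = y" "y = z" by auto
  then show ?thesis by simp
qed

text \<open>If \<open>g x\<close> exceeded \<open>g y\<close>, the graph would descend from
  \<open>x\<close> to \<open>y\<close> and, by concavity, stay below \<open>g y\<close> afterwards,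
  against \<open>g y \<le> g z\<close>.\<close>

lemma rise:
  assumes "x \<in> {c..d}" "z \<in> {c..d}" "x \<le> y" "y < z" "g y \<le> g z"
  shows "g x \<le> g y"
proof -
  have "(z - y) * g x + (y - x) * g z \<le> (z - x) * g y" using concaveD assms by simp
  moreover have "(y - x) * g y \<le> (y - x) * g z" using assms by (intro mult_left_mono) auto
  ultimately have "(z - y) * g x \<le> (z - y) * g y" by (simp add: algebra_simps)
  then show ?thesis using assms by simp
qed

lemma fall:
  assumes "x \<in> {c..d}" "z \<in> {c..d}" "x < y" "y \<le> z" "g y \<le> g x"
  shows "g z \<le> g y"
proof -
  have "(z - y) * g x + (y - x) * g z \<le> (z - x) * g y" using concaveD assms by simp
  moreover have "(z - y) * g y \<le> (z - y) * g x" using assms by (intro mult_left_mono) auto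
  ultimately have "(y - x) * g z \<le> (y - x) * g y" by (simp add: algebra_simps)
  then show ?thesis using assms by simp
qed

lemma rise_peak: "c \<le> x \<Longrightarrow> x \<le> y \<Longrightarrow> y \<le> m \<Longrightarrow> g x \<le> g y"
  using rise[of x m y] peak peak_in by (cases "y = m") auto

lemma fall_peak: "m \<le> x \<Longrightarrow> x \<le> y \<Longrightarrow> y \<le> d \<Longrightarrow> g y \<le> g x"
  using fall[of m y x] peak peak_in by (cases "x = m") auto

section \<open>Trapezoid and midpoint rules, and area estimates\<close>

lemma trapezoid:
  assumes "c \<le> x" "x \<le> y" "y \<le> d"
  shows "(y - x) * (g x + g y) / 2 \<le> I x y"
proof (cases "x = y")
  case False
  define l where "l = (g y - g x) / (y - x)"
  have l: "l * (y - x) = g y - g x" using False by (simp add: l_def)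
  \<comment> \<open>The affine integrand is the chord through \<open>(x, g x)\<close> and
    \<open>(y, g y)\<close>, which lies below a concave graph.\<close>
  have "integral {x..y} (\<lambda>t. (g x - l * x) + l * t) \<le> I x y"
  proof (rule integral_le)
    fix t assume t: "t \<in> {x..y}"
    have "(y - x) * ((g x - l * x) + l * t) = (y - x) * g x + (t - x) * (l * (y - x))"
      by (simp add: algebra_simps)
    also have "\<dots> = (y - t) * g x + (t - x) * g y" unfolding l by (simp add: algebra_simps)
    also have "\<dots> \<le> (y - x) * g t" using concaveD[of x y t] assms t by simp
    finally show "(g x - l * x) + l * t \<le> g t" using assms False by simp
  qed (use assms sub_integrable integral_affine[of x y "g x - l * x" l] in auto)
  moreover have "(y - x) * ((g x - l * x) + l * (x + y) / 2) = (y - x) * (g x + l * (y - x) / 2)"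
    by (simp add: field_simps)
  ultimately show ?thesis
    using integral_unique[OF integral_affine[OF assms(2), of "g x - l * x" l]] l
    by (simp add: field_simps)
qed simp

text \<open>A supporting line at \<open>x\<close> lies above the graph, and its integral over an
  interval centred at \<open>x\<close> is the length times \<open>g x\<close>.\<close>

lemma midpoint:
  assumes "c \<le> x - r" "0 < r" "x + r \<le> d"
  shows "I (x - r) (x + r) \<le> 2 * r * g x"
proof -
  \<comment> \<open>The right derivative of the convex function \<open>- g\<close> at
    \<open>x\<close>, hence a subgradient; the supporting line of \<open>g\<close> has slope
    \<open>- l\<close>.\<close>
  define l where "l = Inf ((\<lambda>t. (- g x - - g t) / (x - t)) ` ({x<..} \<inter> {c..d}))"
  have l: "- g y \<ge> - g x + l * (y - x)" if "y \<in> {c..d}" for y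
    unfolding l_def
    by (rule convex_le_Inf_differential) (use concave assms that in \<open>auto simp: concave_on_def\<close>)
  have "I (x - r) (x + r) \<le> integral {x - r..x + r} (\<lambda>t. (g x + l * x) + (- l) * t)"
  proof (rule integral_le)
    fix t assume t: "t \<in> {x - r..x + r}"
    then show "g t \<le> (g x + l * x) + (- l) * t"
      using l[of t] assms by (simp add: algebra_simps)
  qed (use assms sub_integrable integral_affine[of "x - r" "x + r" "g x + l * x" "- l"] in auto)
  also have "\<dots> = 2 * r * g x"
    using integral_unique[OF integral_affine[of "x - r" "x + r" "g x + l * x" "- l"]] assms
    by (simp add: field_simps)
  finally show ?thesis .
qed

text \<open>Trapezoids are fitted under the graph with heights 0 at \<open>c\<close> and
  \<open>d\<close>, \<open>s\<close> at \<open>x\<close> and \<open>y\<close>, and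
  \<open>g m\<close> at \<open>m\<close>. If \<open>m\<close> lies between \<open>x\<close> and
  \<open>y\<close>, their doubled area is exactly the left side. Otherwise the knot among
  \<open>x\<close>, \<open>y\<close> nearer to \<open>m\<close> is dropped, and
  \<open>s \<le> g m\<close> pays for the difference.\<close>

lemma area:
  assumes "c \<le> x" "x \<le> y" "y \<le> d" "s \<le> g x" "s \<le> g y" "0 \<le> s"
  shows "g m * (y - x) + s * (d - c) \<le> 2 * I c d"
proof -
  have T: "(b - a) * (u + v) \<le> 2 * I a b"
    if "c \<le> a" "a \<le> b" "b \<le> d" "u \<le> g a" "v \<le> g b" for a b u v
  proof -
    have "(b - a) * (u + v) \<le> (b - a) * (g a + g b)" using that by (intro mult_left_mono) auto
    then show ?thesis using trapezoid[of a b] that by simp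
  qed
  have m: "c \<le> m" "m \<le> d" using peak_in by auto
  have M: "s \<le> g m" using peak[of x] assms by simp
  have gc: "0 \<le> g c" "0 \<le> g d" using nonneg m by auto
  consider "m \<le> x" | "x \<le> m" "m \<le> y" | "y \<le> m" by linarith
  then show ?thesis
  proof cases
    case 1
    have "(m - c) * (0 + g m) + (y - m) * (g m + s) + (d - y) * (s + 0) \<le> 2 * I c d"
      using T[of c m 0 "g m"] T[of m y "g m" s] T[of y d s 0] assms m gc 1
        I_combine[of c m d] I_combine[of m y d] by simp
    moreover have "s * (m - c) \<le> g m * (x - c)" using M m assms 1 by (intro mult_mono) auto
    ultimately show ?thesis by (simp add: algebra_simps)
  next
    case 2
    have "(x - c) * (0 + s) + (m - x) * (s + g m) + (y - m) * (g m + s) + (d - y) * (s + 0) \<le> 2 * I c d"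
      using T[of c x 0 s] T[of x m s "g m"] T[of m y "g m" s] T[of y d s 0] assms m gc 2
        I_combine[of c x d] I_combine[of x m d] I_combine[of m y d] by simp
    then show ?thesis by (simp add: algebra_simps)
  next
    case 3
    have "(x - c) * (0 + s) + (m - x) * (s + g m) + (d - m) * (g m + 0) \<le> 2 * I c d"
      using T[of c x 0 s] T[of x m s "g m"] T[of m d "g m" 0] assms m gc 3
        I_combine[of c x d] I_combine[of x m d] by simp
    moreover have "s * (d - m) \<le> g m * (d - y)" using M m assms 3 by (intro mult_mono) auto
    ultimately show ?thesis by (simp add: algebra_simps)
  qed
qed

lemma area_peak: "g m * (d - c) \<le> 2 * I c d"
  using area[of m m "g m"] peak_in peak_pos by auto

text \<open>Replacing \<open>d - c\<close> by \<open>g m\<close> in \<open>area\<close> and dividing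
  by \<open>g m\<close> lets one term pay for both a length, which counts grid lines, and a boundary
  height.\<close>

lemma area_ratio:
  assumes "c \<le> x" "x \<le> y" "y \<le> d" "s \<le> g x" "s \<le> g y" "0 \<le> s"
  shows "(y - x) + s \<le> 2 * I c d / g m"
proof -
  have "s * g m \<le> s * (d - c)" using wide assms by (intro mult_left_mono) auto
  then show ?thesis using area[OF assms] peak_pos by (simp add: field_simps)
qed

section \<open>Sums over the integers and the upper bound\<close>

lemma sum_trapezoid:
  assumes "p \<le> q" "c \<le> of_int p" "of_int q \<le> d"
  shows "(\<Sum>k\<in>{p..q}. g (of_int k)) \<le> I (of_int p) (of_int q) + (g (of_int p) + g (of_int q)) / 2"
  using assms(1,3)
proof (induction q rule: int_ge_induct)
  case (step q)
  have "{p..q + 1} = insert (q + 1) {p..q}" using step by auto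
  then show ?case
    using step trapezoid[of "of_int q" "of_int q + 1"] I_combine[of "of_int p" "of_int q" "of_int q + 1"] assms
    by (simp add: field_simps)
qed simp

text \<open>Each integer is the centre of a unit cell to which the midpoint rule applies. The case
  \<open>q = p - 1\<close>, an empty sum and an interval of length zero, starts the
  induction.\<close>

lemma sum_midpoint:
  assumes "p - 1 \<le> q" "c \<le> of_int p - 1/2" "of_int q + 1/2 \<le> d"
  shows "I (of_int p - 1/2) (of_int q + 1/2) \<le> (\<Sum>k\<in>{p..q}. g (of_int k))"
  using assms(1,3)
proof (induction q rule: int_ge_induct)
  case (step q)
  have "{p..q + 1} = insert (q + 1) {p..q}" using step by auto
  moreover have "I (of_int p - 1/2) (of_int (q + 1) + 1/2) =
      I (of_int p - 1/2) (of_int q + 1/2) + I (of_int q + 1/2) (of_int (q + 1) + 1/2)"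
    using step assms by (intro I_combine) auto
  moreover have "I (of_int q + 1/2) (of_int (q + 1) + 1/2) \<le> g (of_int (q + 1))"
    using midpoint[of "of_int q + 1" "1/2"] step assms by (simp add: algebra_simps)
  ultimately show ?case
    using step by simp
qed simp

text \<open>With V the integral and M the maximum, the bound expands to V + V/L + 2V/M + 2V/(M L).
  These terms pay in turn for the integral, for M/2, for the length \<open>q - p\<close> plus the
  smaller end value, and for the one extra grid line.\<close>

lemma sum_upper:
  assumes "p \<le> q" "c \<le> of_int p" "of_int q \<le> d" "g m \<le> L" "L \<le> d - c"
  shows "(\<Sum>k\<in>{p..q}. g (of_int k) + 1) \<le> I c d * (1 + 1 / L) * (1 + 2 / g m)"
proof -
  define s where "s = min (g (of_int p)) (g (of_int q))"
  have L: "0 < L" using assms peak_pos by linarith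
  have pq: "real_of_int p \<le> of_int q" using assms by simp
  have gp: "0 \<le> g (of_int p)" "0 \<le> g (of_int q)" "g (of_int p) \<le> g m" "g (of_int q) \<le> g m"
    using nonneg peak assms pq by auto
  then have s: "0 \<le> s" "(g (of_int p) + g (of_int q)) / 2 \<le> s + g m / 2" by (auto simp: s_def)
  have r: "(of_int q - of_int p) + s \<le> 2 * I c d / g m"
    by (rule area_ratio) (use assms pq s in \<open>auto simp: s_def\<close>)
  have "g m * L \<le> 2 * I c d"
    using area_peak mult_left_mono[OF assms(5), of "g m"] peak_pos by linarith
  then have v: "g m / 2 \<le> I c d / L" "1 \<le> 2 * I c d / (g m * L)"
    using L peak_pos by (simp_all add: field_simps)
  have "I (of_int p) (of_int q) \<le> I c d"
    using sub_integrable[of c d] sub_integrable[of "of_int p" "of_int q"] assms nonneg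
    by (intro integral_subset_le) auto
  moreover have "(\<Sum>k\<in>{p..q}. g (of_int k) + 1) = (\<Sum>k\<in>{p..q}. g (of_int k)) + (of_int q - of_int p + 1)"
    using assms by (simp add: sum.distrib)
  moreover have e: "I c d * (1 + 1 / L) * (1 + 2 / g m)
      = I c d + I c d / L + 2 * I c d / g m + 2 * I c d / (g m * L)"
    using L peak_pos by (simp add: field_simps)
  moreover note sum_trapezoid[OF assms(1-3)]
  ultimately have "(\<Sum>k\<in>{p..q}. g (of_int k) + 1) \<le> I c d + s + g m / 2 + (of_int q - of_int p + 1)"
    using s by linarith
  also have "\<dots> \<le> I c d + I c d / L + 2 * I c d / g m + 1" using r v(1) by linarith
  also have "\<dots> \<le> I c d + I c d / L + 2 * I c d / g m + 2 * I c d / (g m * L)" using v(2) by linarith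
  finally show ?thesis unfolding e .
qed

text \<open>When the profile is cut to an interval ending at half-integers, a removed end piece of length
  \<open>r > 1/2\<close> still contains a grid line \<open>x\<close>, at distance \<open>1/2\<close> from the cut. It is counted only
  if it contributes positively.\<close>

definition gain :: "real \<Rightarrow> real \<Rightarrow> real" where
  "gain r x = (if 1/2 < r then max (g x - 1) 0 else 0)"

text \<open>Among all ends \<open>e\<close> with \<open>s \<le> g e\<close>, where \<open>s = g a\<close>, one is chosen for which the two
  end pieces cost at most \<open>s + g m / 2 + (e - b)\<close>; the area estimate \<open>area_ratio\<close> pays for \<open>s\<close> and
  the length \<open>e - a\<close>, and \<open>g m / 2\<close> remains. The choice is \<open>e = b\<close> for a short end piece, the
  extra grid line \<open>q\<close> if \<open>s \<le> g q\<close>, and a crossing \<open>g e = s\<close> otherwise.\<close>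

lemma lower_oriented:
  assumes ab: "c \<le> a" "a < b" "b \<le> d" "a - c < 1" "d - b < 1" and M: "2 \<le> g m"
    and le: "g a \<le> g b"
  shows "I c d - I a b + (b - a) - gain (a - c) (a - 1/2) - gain (d - b) (b + 1/2)
    \<le> 2 * I c d / g m + g m / 2"
proof -
  define s where "s = g a"
  have s: "0 \<le> s" "s \<le> g m" using nonneg peak ab by (auto simp: s_def)
  have left_le: "g x \<le> s" if "x \<in> {c..a}" for x
    using rise[of x b a] that ab le by (auto simp: s_def)
  have gain0: "0 \<le> gain r x" for r x by (simp add: gain_def)
  have split: "I c d = I c a + I a b + I b d" using I_combine[of c a d] I_combine[of a b d] ab by simp
  have l0: "I c a \<le> (a - c) * s" using I_le[of c a s] left_le ab by auto
  \<comment> \<open>The left end piece gets two bounds: \<open>l1\<close> is the better one for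
    \<open>s \<le> 1\<close>, \<open>l2\<close> for \<open>s \<ge> 1\<close>.\<close>
  have "(a - c) * s \<le> s" using ab s by (intro mult_left_le_one_le) auto
  with l0 have l1: "I c a - gain (a - c) (a - 1/2) \<le> s" using gain0[of "a - c" "a - 1/2"] by linarith
  have l2: "I c a - gain (a - c) (a - 1/2) \<le> s / 2 + 1 / 2"
  proof (cases "1/2 < a - c")
    case True
    define p where "p = a - 1/2"
    define y where "y = g p"
    have p: "c < p" "p < a" "p - c \<le> 1/2" using True ab by (auto simp: p_def)
    have y0: "0 \<le> y" using nonneg p ab by (auto simp: y_def)
    have "I p a \<le> (a - p) * s" using I_le[of p a s] left_le p ab by auto
    moreover have "g x \<le> y" if "x \<in> {c..p}" for x
      using rise[of x a p] that p ab left_le[of p] by (auto simp: y_def s_def)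
    then have "I c p \<le> (p - c) * y" using I_le[of c p y] p ab by auto
    moreover have "(p - c) * y \<le> 1/2 * y" using p y0 by (intro mult_right_mono) auto
    moreover have "gain (a - c) (a - 1/2) = max (y - 1) 0"
      using True by (simp add: gain_def y_def p_def)
    \<comment> \<open>Rests on \<open>y / 2 - max (y - 1) 0 \<le> 1 / 2\<close>, with equality at
      \<open>y = 1\<close>.\<close>
    ultimately show ?thesis using I_combine[of c p a] p ab unfolding p_def by (simp add: max_def)
  next
    case False
    then have "(a - c) * s \<le> 1/2 * s" using s by (intro mult_right_mono) auto
    then show ?thesis using l0 gain0[of "a - c" "a - 1/2"] by linarith
  qed
  obtain e where e: "a \<le> e" "b \<le> e" "e \<le> d" "s \<le> g e"
    and rem: "I c a - gain (a - c) (a - 1/2) + (I b d - gain (d - b) (b + 1/2) - (e - b)) \<le> s + g m / 2"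
  proof (cases "1/2 < d - b")
    case False
    have "I b d \<le> (d - b) * g m" using I_le[of b d "g m"] peak ab by auto
    also have "\<dots> \<le> 1/2 * g m" using False peak_pos by (intro mult_right_mono) auto
    finally have "I b d - gain (d - b) (b + 1/2) - (b - b) \<le> g m / 2"
      using gain0[of "d - b" "b + 1/2"] by linarith
    with l1 ab le that[of b] show ?thesis by (simp add: s_def)
  next
    case True
    define q where "q = b + 1/2"
    define y where "y = g q"
    have q: "b < q" "q < d" "d - q \<le> 1/2" "q - b = 1/2" using True ab by (auto simp: q_def)
    have y0: "0 \<le> y" using nonneg q ab by (auto simp: y_def)
    have gn: "gain (d - b) (b + 1/2) = max (y - 1) 0"
      using True by (simp add: gain_def y_def q_def)
    have spl: "I b d = I b q + I q d" using I_combine[of b q d] q ab by simp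
    have tail: "I q d \<le> y / 2" if "\<And>x. x \<in> {q..d} \<Longrightarrow> g x \<le> y"
    proof -
      have "I q d \<le> (d - q) * y" using I_le[of q d y] that q ab by auto
      also have "\<dots> \<le> 1/2 * y" using q y0 by (intro mult_right_mono) auto
      finally show ?thesis by simp
    qed
    show ?thesis
    proof (cases "s \<le> y")
      case True
      \<comment> \<open>Of the two pieces on either side of \<open>q\<close>, the one away from the
        peak has \<open>g \<le> y\<close>; the other is bounded by the maximum. Both have length at
        most 1/2.\<close>
      have "I b d \<le> y / 2 + g m / 2"
      proof (cases "q \<le> m")
        case True
        have "I b q \<le> (q - b) * y"
          using rise_peak[of _ q] True q ab by (intro I_le) (auto simp: y_def)
        moreover have "I q d \<le> (d - q) * g m" using I_le[of q d "g m"] peak q ab by auto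
        moreover have "(d - q) * g m \<le> 1/2 * g m" using q peak_pos by (intro mult_right_mono) auto
        ultimately show ?thesis using spl q by simp
      next
        case False
        have "I b q \<le> (q - b) * g m" using peak q ab by (intro I_le) auto
        moreover have "I q d \<le> y / 2"
          using fall_peak[of q] False by (intro tail) (auto simp: y_def)
        ultimately show ?thesis using spl q by simp
      qed
      \<comment> \<open>Moving the end to \<open>q\<close> subtracts 1/2, and
        \<open>y / 2 - 1 / 2 \<le> max (y - 1) 0\<close>.\<close>
      then have "I b d - gain (d - b) (b + 1/2) - (q - b) \<le> g m / 2"
        unfolding gn q(4) by linarith
      with l1 True q ab that[of q] show ?thesis by (simp add: y_def)
    next
      case False
      \<comment> \<open>A concave profile can jump at \<open>c\<close> and \<open>d\<close>, but
        \<open>{b..q}\<close> lies in the open interval, so the descent from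
        \<open>g b \<ge> s\<close> to \<open>y < s\<close> has a crossing.\<close>
      have "continuous_on {c<..<d} (\<lambda>x. - g x)"
        using concave by (intro convex_on_continuous)
          (auto simp: concave_on_def intro: convex_on_subset)
      then have "continuous_on {b..q} (\<lambda>x. - g x)"
        by (rule continuous_on_subset) (use q ab in auto)
      then obtain e where e: "b \<le> e" "e \<le> q" "g e = s"
        using IVT'[of "\<lambda>x. - g x" b "- s" q] False le q by (auto simp: s_def y_def)
      define t where "t = e - b"
      have t: "0 \<le> t" "t \<le> 1/2" "q - e = 1/2 - t" using e q by (auto simp: t_def)
      have "e < q" using e False by (cases "e = q") (auto simp: y_def)
      have "I b e \<le> t * g m" using I_le[of b e "g m"] peak q ab e by (auto simp: t_def)
      moreover have "I e q \<le> (1/2 - t) * s"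
        using I_le[of e q s] fall[of a _ e] q ab e by (auto simp: s_def t(3))
      moreover have "I q d \<le> y / 2"
        using fall[of e _ q] q ab e False \<open>e < q\<close> by (intro tail) (auto simp: y_def)
      ultimately have r: "I b d - (e - b) \<le> y / 2 + s / 2 + t * (g m - s - 1)"
        using I_combine[of b e q] spl q ab e by (simp add: t_def algebra_simps)
      have y: "y / 2 - max (y - 1) 0 \<le> 1/2" "y / 2 \<le> s / 2" using False by (auto simp: max_def)
      \<comment> \<open>The expression is linear in \<open>t\<close> on [0, 1/2], hence at most the
        larger of its two end values.\<close>
      have tt: "t * (g m - s - 1) \<le> 0 \<or> t * (g m - s - 1) \<le> (g m - s - 1) / 2"
      proof (cases "0 \<le> g m - s - 1")
        case True
        then have "t * (g m - s - 1) \<le> 1/2 * (g m - s - 1)" using t by (intro mult_right_mono)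
        then show ?thesis by linarith
      next
        case False
        then have "t * (g m - s - 1) \<le> 0" using t by (intro mult_nonneg_nonpos) auto
        then show ?thesis by simp
      qed
      \<comment> \<open>For \<open>s \<ge> 1\<close> the bounds \<open>l2\<close> and
        \<open>y(1)\<close> suffice, for \<open>s < 1\<close> the bounds \<open>l1\<close> and
        \<open>y(2)\<close>; both cases use \<open>2 \<le> g m\<close>.\<close>
      have "I c a - gain (a - c) (a - 1/2) + (I b d - gain (d - b) (b + 1/2) - (e - b)) \<le> s + g m / 2"
      proof (cases "1 \<le> s")
        case True
        then show ?thesis using r y(1) tt l2 M s unfolding gn by argo
      next
        case False
        then show ?thesis using r y(2) tt l1 M s unfolding gn by argo
      qed
      then show ?thesis using that[of e] e q ab by simp
    qed
  qed
  have "(e - a) + s \<le> 2 * I c d / g m"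
    by (rule area_ratio) (use e ab s in \<open>auto simp: s_def\<close>)
  then show ?thesis using rem split by linarith
qed

lemma lower_cut:
  assumes ab: "c \<le> a" "a < b" "b \<le> d" "a - c < 1" "d - b < 1" and M: "2 \<le> g m"
  shows "I c d - I a b + (b - a) - gain (a - c) (a - 1/2) - gain (d - b) (b + 1/2)
    \<le> 2 * I c d / g m + g m / 2"
proof (cases "g a \<le> g b")
  case True
  then show ?thesis using lower_oriented assms by blast
next
  case False
  interpret R: concave_profile "\<lambda>x. g (- x)" "- d" "- c" "- m" by (rule reflect)
  have gain: "R.gain r x = gain r (- x)" for r x by (simp add: gain_def R.gain_def)
  have "R.I (- d) (- c) - R.I (- b) (- a) + (b - a) - R.gain (d - b) (- b - 1/2) - R.gain (a - c) (- a + 1/2)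
    \<le> 2 * R.I (- d) (- c) / g m + g m / 2"
    using R.lower_oriented[of "- b" "- a"] assms False by simp
  then show ?thesis unfolding gain by (simp add: algebra_simps integral_reflect_real)
qed

text \<open>The midpoint rule handles the full unit cells and \<open>lower_cut\<close> the two end
  pieces; the remaining \<open>g m / 2\<close> is at most \<open>I c d / L\<close>. In the
  application \<open>N k\<close> counts interior points on one grid line.\<close>

lemma sum_lower:
  assumes "2 \<le> g m" "2 < d - c" "g m \<le> L" "L \<le> d - c"
    and N: "\<And>k. 0 \<le> N k" "\<And>k. c < of_int k \<Longrightarrow> of_int k < d \<Longrightarrow> g (of_int k) - 1 \<le> N k"
    and fin: "finite A" and A: "\<And>k. c < of_int k \<Longrightarrow> of_int k < d \<Longrightarrow> k \<in> A"
  shows "I c d * (1 - 1 / L - 2 / g m) \<le> (\<Sum>k\<in>A. N k)"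
proof -
  \<comment> \<open>The first and last integers whose unit cell lies in \<open>{c..d}\<close>; width
    above 2 makes \<open>a < b\<close>.\<close>
  define p q where "p = \<lceil>c + 1/2\<rceil>" and "q = \<lfloor>d - 1/2\<rfloor>"
  define a b where "a = of_int p - (1/2::real)" and "b = of_int q + (1/2::real)"
  have ab: "c \<le> a" "a < b" "b \<le> d" "a - c < 1" "d - b < 1"
    using assms(2) unfolding a_def b_def p_def q_def by linarith+
  then have pq: "p \<le> q" unfolding a_def b_def by linarith
  have "g m * L \<le> 2 * I c d"
    using area_peak mult_left_mono[OF assms(4), of "g m"] peak_pos by linarith
  then have v: "g m / 2 \<le> I c d / L"
    using assms(1,3) by (simp add: field_simps)
  have "I a b - (b - a) \<le> (\<Sum>k\<in>{p..q}. g (of_int k) - 1)"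
    using sum_midpoint[of p q] pq ab unfolding a_def b_def by (simp add: sum_subtractf)
  also have "\<dots> \<le> (\<Sum>k\<in>{p..q}. N k)"
    using ab unfolding a_def b_def by (intro sum_mono N(2)) auto
  finally have mid: "I a b - (b - a) \<le> (\<Sum>k\<in>{p..q}. N k)" .
  \<comment> \<open>Extension by zero: \<open>p - 1\<close> or \<open>q + 1\<close> can fall outside
    \<open>A\<close>, but then its end piece has length at most 1/2 and the gain is zero.\<close>
  define N' where "N' k = (if k \<in> A then N k else 0)" for k
  have "gain (a - c) (a - 1/2) \<le> N' (p - 1)"
    using N(1)[of "p - 1"] N(2)[of "p - 1"] A[of "p - 1"] ab pq
    by (auto simp: gain_def N'_def a_def b_def)
  moreover have "gain (d - b) (b + 1/2) \<le> N' (q + 1)"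
    using N(1)[of "q + 1"] N(2)[of "q + 1"] A[of "q + 1"] ab pq
    by (auto simp: gain_def N'_def a_def b_def add.commute)
  moreover have "(\<Sum>k\<in>{p..q}. N k) = (\<Sum>k\<in>{p..q}. N' k)"
    using ab A by (intro sum.cong) (auto simp: N'_def a_def b_def)
  moreover have "N' (p - 1) + (\<Sum>k\<in>{p..q}. N' k) + N' (q + 1) = (\<Sum>k\<in>{p - 1..q + 1}. N' k)"
  proof -
    have "{p - 1..q + 1} = insert (p - 1) (insert (q + 1) {p..q})" using pq by auto
    then show ?thesis using pq by simp
  qed
  moreover have "(\<Sum>k\<in>{p - 1..q + 1}. N' k) = (\<Sum>k\<in>{p - 1..q + 1} \<inter> A. N k)"
    by (simp add: N'_def sum.inter_restrict)
  moreover have "\<dots> \<le> (\<Sum>k\<in>A. N k)"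
    using N(1) fin by (intro sum_mono2) auto
  moreover have "I c d * (1 - 1 / L - 2 / g m) = I c d - I c d / L - 2 * I c d / g m"
    by (simp add: algebra_simps)
  ultimately show ?thesis using lower_cut[OF ab assms(1)] mid v by linarith
qed

end

section \<open>Lattice points in planar convex sets by slicing\<close>

lemma slice_has_integral:
  fixes S :: "(real \<times> real) set"
  assumes "compact S" and fst_image: "fst ` S \<subseteq> {c..d}"
  shows "((\<lambda>x. measure lborel (Pair x -` S)) has_integral measure lborel S) {c..d}"
proof -
  have S: "S \<in> sets lborel" using assms by (simp add: borel_compact)
  have "integrable lborel (indicator S :: _ \<Rightarrow> real)"
    using emeasure_compact_finite[OF assms(1)] S by (intro integrable_real_indicator) (auto simp: less_top)
  then have int: "integrable (lborel \<Otimes>\<^sub>M lborel) (indicator S :: _ \<Rightarrow> real)"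
    by (simp add: lborel_prod)
  have ind: "(\<lambda>y. indicator S (x, y) :: real) = indicator (Pair x -` S)" for x
    by (auto simp: indicator_def)
  have "integrable lborel (\<lambda>x. measure lborel (Pair x -` S))"
    using lborel_pair.integrable_fst'[OF int] by (simp add: ind)
  then have "((\<lambda>x. measure lborel (Pair x -` S)) has_integral
      (\<integral>x. measure lborel (Pair x -` S) \<partial>lborel)) UNIV"
    by (rule has_integral_integral_lborel)
  moreover have "(\<integral>x. measure lborel (Pair x -` S) \<partial>lborel) = measure lborel S"
    using lborel_pair.integral_fst'[OF int] by (simp add: ind lborel_prod)
  moreover have "Pair x -` S = {}" if "x \<notin> {c..d}" for x using fst_image that by force
  then have "(if x \<in> {c..d} then measure lborel (Pair x -` S) else 0) = measure lborel (Pair x -` S)" for x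
    by simp
  ultimately show ?thesis by (subst has_integral_restrict_UNIV[symmetric]) simp
qed

lemma card_ints_le:
  assumes "l \<le> h"
  shows "real (card {j::int. l \<le> of_int j \<and> of_int j \<le> h}) \<le> h - l + 1"
proof -
  have "{j::int. l \<le> of_int j \<and> of_int j \<le> h} = {\<lceil>l\<rceil>..\<lfloor>h\<rfloor>}"
    by (auto simp: le_floor_iff ceiling_le_iff)
  then show ?thesis using assms by simp linarith
qed

lemma card_ints_ge:
  fixes l h :: real
  assumes "finite A" "\<And>j::int. l < of_int j \<Longrightarrow> of_int j < h \<Longrightarrow> j \<in> A"
  shows "h - l - 1 \<le> real (card A)"
proof -
  have "{\<lfloor>l\<rfloor> + 1..\<lceil>h\<rceil> - 1} \<subseteq> A" using assms(2) by (auto intro!: assms(2)) linarith+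
  then have "card {\<lfloor>l\<rfloor> + 1..\<lceil>h\<rceil> - 1} \<le> card A" using assms(1) by (intro card_mono)
  then show ?thesis by simp linarith
qed

text \<open>Separating \<open>z\<close> from the open set \<open>interior S\<close> suffices, since
  a convex set with interior points lies in the closure of its interior.\<close>

lemma supporting_functional:
  fixes S :: "'a::euclidean_space set"
  assumes "convex S" "interior S \<noteq> {}" "z \<notin> interior S"
  obtains a where "a \<noteq> 0" "\<And>x. x \<in> S \<Longrightarrow> a \<bullet> x \<le> a \<bullet> z"
proof -
  obtain a b where a: "a \<noteq> 0" "\<forall>x\<in>interior S. a \<bullet> x \<le> b" "\<forall>x\<in>{z}. b \<le> a \<bullet> x"
    using separating_hyperplane_sets[of "interior S" "{z}"] assms by (auto simp: convex_interior)
  have "closure (interior S) \<subseteq> {x. a \<bullet> x \<le> a \<bullet> z}"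
    using a by (intro closure_minimal closed_halfspace_le) force+
  then have "S \<subseteq> {x. a \<bullet> x \<le> a \<bullet> z}"
    using convex_closure_interior[OF assms(1,2)] closure_subset by blast
  then show ?thesis using that a(1) by blast
qed

text \<open>Otherwise some nonzero functional on \<open>S\<close> would be at most its value at the
  point. Points of \<open>S\<close> above and below force its vertical part to vanish, points to the
  left and right its horizontal part.\<close>

lemma interior_between_chords:
  fixes S :: "(real \<times> real) set"
  assumes "convex S" "interior S \<noteq> {}"
    and "(x, l) \<in> S" "(x, h) \<in> S" "(c, u) \<in> S" "(d, v) \<in> S"
    and "c < x" "x < d" "l < y" "y < h"
  shows "(x, y) \<in> interior S"
proof (rule ccontr)
  assume "(x, y) \<notin> interior S"
  then obtain a where a: "a \<noteq> 0" "\<And>z. z \<in> S \<Longrightarrow> a \<bullet> z \<le> a \<bullet> (x, y)"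
    using supporting_functional assms by metis
  obtain p q where pq: "a = (p, q)" by (cases a)
  have h: "p * x + q * h \<le> p * x + q * y" "p * x + q * l \<le> p * x + q * y"
    "p * c + q * u \<le> p * x + q * y" "p * d + q * v \<le> p * x + q * y"
    using a(2) assms(3-6) by (fastforce simp: pq)+
  have "q * (h - y) \<le> 0" "0 \<le> q * (y - l)" using h(1,2) by (auto simp: algebra_simps)
  then have q: "q = 0" using assms by (smt (verit) mult_pos_pos mult_neg_pos)
  have "0 \<le> p * (x - c)" "p * (d - x) \<le> 0" using h(3,4) q by (auto simp: algebra_simps)
  then have "p = 0" using assms by (smt (verit) mult_pos_pos mult_neg_pos)
  then show False using q pq a(1) by (simp add: zero_prod_def)
qed

text \<open>Both inequalities in reduced coordinates, with \<open>L\<close> and \<open>M\<close>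
  standing for 2/lambda_1 and 2/lambda_2. The longest vertical chord \<open>g m\<close> lies between
  \<open>M\<close> and \<open>L\<close>, and passing from \<open>g m\<close> to \<open>M\<close>
  only weakens the bounds.\<close>

lemma planar_count_bounds:
  fixes S :: "(real \<times> real) set"
  assumes cpt: "compact S" and cvx: "convex S" and int: "interior S \<noteq> {}"
    and width: "(x1, y1) \<in> S" "(x1 + L, y2) \<in> S"
    and chord: "(x0, y0) \<in> S" "(x0, y0 + M) \<in> S" "0 < M"
    and chord_le: "\<And>x y y'. (x, y) \<in> S \<Longrightarrow> (x, y') \<in> S \<Longrightarrow> y' - y \<le> L"
  shows "real (card {(i :: int, j :: int). (of_int i, of_int j) \<in> S})
      \<le> measure lborel S * (1 + 1 / L) * (1 + 2 / M)"
    and "measure lborel S * (1 - 1 / L - 2 / M)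
      \<le> real (card {(i :: int, j :: int). (of_int i, of_int j) \<in> interior S})"
proof -
  have L: "M \<le> L" "0 < L" using chord_le[OF chord(1,2)] chord(3) by auto
  have "compact (fst ` S)" using cpt by (intro compact_continuous_image continuous_intros)
  moreover have "connected (fst ` S)"
    using cvx by (intro connected_continuous_image convex_connected continuous_intros)
  ultimately obtain c d where cd: "fst ` S = {c..d}" using connected_compact_interval_1 by metis
  have wide: "L \<le> d - c"
  proof -
    have "x1 \<in> fst ` S" "x1 + L \<in> fst ` S" using width by force+
    then show ?thesis unfolding cd by auto
  qed
  have "\<exists>l h. Pair x -` S = {l..h} \<and> l \<le> h" if "x \<in> {c..d}" for x
  proof -
    have "snd ` (S \<inter> {x} \<times> UNIV) = Pair x -` S" by force
    moreover have "compact (snd ` (S \<inter> {x} \<times> UNIV))"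
      using cpt by (intro compact_continuous_image compact_Int_closed closed_Times continuous_intros) auto
    moreover have "connected (snd ` (S \<inter> {x} \<times> UNIV))"
      using cvx by (intro connected_continuous_image convex_connected convex_Int convex_Times
          continuous_intros) auto
    ultimately obtain l h where "Pair x -` S = {l..h}" using connected_compact_interval_1 by metis
    moreover have "Pair x -` S \<noteq> {}" using that unfolding cd[symmetric] by force
    ultimately show ?thesis by auto
  qed
  then obtain lo hi where slice: "\<And>x. x \<in> {c..d} \<Longrightarrow> Pair x -` S = {lo x..hi x}"
    and lohi: "\<And>x. x \<in> {c..d} \<Longrightarrow> lo x \<le> hi x" by metis
  have mem: "(x, y) \<in> S \<longleftrightarrow> x \<in> {c..d} \<and> lo x \<le> y \<and> y \<le> hi x" for x y
  proof (cases "x \<in> {c..d}")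
    case True
    have "(x, y) \<in> S \<longleftrightarrow> y \<in> Pair x -` S" by simp
    then show ?thesis using slice[OF True] True by auto
  next
    case False
    then have "x \<notin> fst ` S" using cd by simp
    then show ?thesis using False by force
  qed
  define g where "g x = measure lborel (Pair x -` S)" for x
  have g: "g x = hi x - lo x" if "x \<in> {c..d}" for x
    using slice[OF that] lohi[OF that] by (simp add: g_def)
  have g_int: "(g has_integral measure lborel S) {c..d}"
    using slice_has_integral[OF cpt, of c d] cd unfolding g_def by simp
  have conc: "concave_on {c..d} g"
    unfolding concave_on_iff
  proof (intro conjI ballI allI impI)
    fix x y u v :: real
    assume xy: "x \<in> {c..d}" "y \<in> {c..d}" and uv: "0 \<le> u" "0 \<le> v" "u + v = 1"
    then have z: "u *\<^sub>R x + v *\<^sub>R y \<in> {c..d}" using convexD[of "{c..d}" x y u v] by simp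
    have ends: "(x, lo x) \<in> S" "(y, lo y) \<in> S" "(x, hi x) \<in> S" "(y, hi y) \<in> S"
      using xy lohi by (auto simp: mem)
    have "u *\<^sub>R (x, lo x) + v *\<^sub>R (y, lo y) \<in> S" "u *\<^sub>R (x, hi x) + v *\<^sub>R (y, hi y) \<in> S"
      by (rule convexD[OF cvx _ _ uv]; fact ends)+
    then have "lo (u * x + v * y) \<le> u * lo x + v * lo y" "u * hi x + v * hi y \<le> hi (u * x + v * y)"
      by (auto simp: mem)
    then show "u * g x + v * g y \<le> g (u *\<^sub>R x + v *\<^sub>R y)"
      unfolding g[OF xy(1)] g[OF xy(2)] g[OF z] by (simp add: algebra_simps)
  qed simp
  \<comment> \<open>Pairs of points of \<open>S\<close> on a common vertical line; compactness
    yields a longest vertical chord, whose abscissa becomes \<open>m\<close>.\<close>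
  define T where "T = S \<times> S \<inter> {p. fst (fst p) = fst (snd p)}"
  have "compact T" unfolding T_def
    using cpt by (intro compact_Int_closed compact_Times closed_Collect_eq continuous_intros) auto
  moreover have cont: "continuous_on T (\<lambda>p. snd (snd p) - snd (fst p))"
    by (intro continuous_intros)
  moreover have "((x0, y0), (x0, y0 + M)) \<in> T" using chord by (simp add: T_def)
  ultimately obtain p where p: "p \<in> T" "\<And>q. q \<in> T \<Longrightarrow> snd (snd q) - snd (fst q) \<le> snd (snd p) - snd (fst p)"
    using continuous_attains_sup[OF _ _ cont] by (metis empty_iff)
  define m where "m = fst (fst p)"
  have "(m, snd (fst p)) \<in> S" "(m, snd (snd p)) \<in> S"
    using p(1) by (auto simp: T_def m_def)
  then have m: "m \<in> {c..d}" "lo m \<le> snd (fst p)" "snd (snd p) \<le> hi m" by (auto simp: mem)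
  note gm = g[OF m(1)]
  have peak: "y' - y \<le> g m" if "(x, y) \<in> S" "(x, y') \<in> S" for x y y'
    using p(2)[of "((x, y), (x, y'))"] that m(2,3) gm by (simp add: T_def)
  have gM: "M \<le> g m" using peak[OF chord(1,2)] by simp
  have gL: "g m \<le> L" using chord_le[of m "lo m" "hi m"] m(1) gm lohi[OF m(1)] by (simp add: mem)
  interpret P: concave_profile g c d m
  proof
    show "g integrable_on {c..d}" using g_int by blast
  next
    fix x assume x: "x \<in> {c..d}"
    show "g x \<le> g m" using peak[of x "lo x" "hi x"] g[OF x] lohi[OF x] x by (simp add: mem)
    show "0 \<le> g x" using g[OF x] lohi[OF x] by simp
  qed (use m(1) gM gL wide chord(3) conc in auto)
  have V: "P.I c d = measure lborel S" using g_int by blast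
  have V0: "0 \<le> measure lborel S" by simp
  define N where "N k = {j :: int. (of_int k, of_int j) \<in> S}" for k :: int
  define N' where "N' k = {j :: int. (of_int k, of_int j) \<in> interior S}" for k :: int
  have N_eq: "N k = (if of_int k \<in> {c..d} then {j. lo (of_int k) \<le> of_int j \<and> of_int j \<le> hi (of_int k)} else {})" for k
    by (auto simp: N_def mem)
  have finN: "finite (N k)" for k
  proof (rule finite_subset)
    show "N k \<subseteq> {\<lceil>lo (of_int k)\<rceil>..\<lfloor>hi (of_int k)\<rfloor>}"
      by (auto simp: N_eq le_floor_iff ceiling_le_iff split: if_splits)
  qed simp
  have N'N: "N' k \<subseteq> N k" for k using interior_subset by (auto simp: N_def N'_def)
  then have finN': "finite (N' k)" for k using finN finite_subset by blast
  have outer: "{(i :: int, j :: int). (of_int i, of_int j) \<in> S} = Sigma {\<lceil>c\<rceil>..\<lfloor>d\<rfloor>} N"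
    by (auto simp: N_def mem le_floor_iff ceiling_le_iff)
  have inner: "{(i :: int, j :: int). (of_int i, of_int j) \<in> interior S} = Sigma {\<lceil>c\<rceil>..\<lfloor>d\<rfloor>} N'"
  proof -
    have "N' i = {}" if "i \<notin> {\<lceil>c\<rceil>..\<lfloor>d\<rfloor>}" for i
      using that N'N[of i] by (auto simp: N_eq le_floor_iff ceiling_le_iff split: if_splits)
    then show ?thesis unfolding N'_def by fastforce
  qed

  show "real (card {(i :: int, j :: int). (of_int i, of_int j) \<in> S})
      \<le> measure lborel S * (1 + 1 / L) * (1 + 2 / M)"
  proof -
    have "real (card {(i :: int, j :: int). (of_int i, of_int j) \<in> S}) \<le> (\<Sum>k\<in>{\<lceil>c\<rceil>..\<lfloor>d\<rfloor>}. g (of_int k) + 1)"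
      unfolding outer card_SigmaI[OF finite_atLeastAtMost_int ballI[OF finN]] of_nat_sum
    proof (rule sum_mono)
      fix k assume "k \<in> {\<lceil>c\<rceil>..\<lfloor>d\<rfloor>}"
      then have k: "of_int k \<in> {c..d}" by (auto simp: le_floor_iff ceiling_le_iff)
      then show "real (card (N k)) \<le> g (of_int k) + 1"
        using card_ints_le[OF lohi[OF k]] g[OF k] by (simp add: N_eq)
    qed
    also have "\<dots> \<le> measure lborel S * (1 + 1 / L) * (1 + 2 / g m)"
    proof (cases "\<lceil>c\<rceil> \<le> \<lfloor>d\<rfloor>")
      case True
      then show ?thesis using P.sum_upper[of "\<lceil>c\<rceil>" "\<lfloor>d\<rfloor>" L] gL wide V by simp
    next
      case False
      then show ?thesis using V0 L P.peak_pos by simp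
    qed
    also have "\<dots> \<le> measure lborel S * (1 + 1 / L) * (1 + 2 / M)"
      using gM chord(3) L V0 by (intro mult_left_mono add_left_mono divide_left_mono) auto
    finally show ?thesis .
  qed
  show "measure lborel S * (1 - 1 / L - 2 / M)
      \<le> real (card {(i :: int, j :: int). (of_int i, of_int j) \<in> interior S})"
  proof -
    have "2 / g m \<le> 2 / M" using gM chord(3) by (intro divide_left_mono) auto
    then have le: "measure lborel S * (1 - 1 / L - 2 / M) \<le> measure lborel S * (1 - 1 / L - 2 / g m)"
      by (intro mult_left_mono) auto
    show ?thesis
    \<comment> \<open>Otherwise the left side is not positive: \<open>g m < 2\<close> gives
      \<open>2 / g m > 1\<close>, and width at most 2 together with \<open>2 \<le> g m\<close>
      forces \<open>g m = L = 2\<close>.\<close>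
    proof (cases "2 \<le> g m \<and> 2 < d - c")
      case True
      have "measure lborel S * (1 - 1 / L - 2 / g m) \<le> (\<Sum>k\<in>{\<lceil>c\<rceil>..\<lfloor>d\<rfloor>}. real (card (N' k)))"
        unfolding V[symmetric]
      proof (rule P.sum_lower)
        fix k :: int assume k: "c < of_int k" "of_int k < d"
        then have x: "of_int k \<in> {c..d}" by simp
        have "c \<in> {c..d}" "d \<in> {c..d}" using k by auto
        note e = lohi[OF this(1)] lohi[OF this(2)]
        show "g (of_int k) - 1 \<le> real (card (N' k))"
          unfolding g[OF x]
        proof (rule card_ints_ge[OF finN'])
          fix j :: int assume "lo (of_int k) < of_int j" "of_int j < hi (of_int k)"
          then show "j \<in> N' k" unfolding N'_def mem_Collect_eq using k e lohi[OF x]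
            by (intro interior_between_chords[OF cvx int, of _ "lo (of_int k)" "hi (of_int k)" c "lo c" d "lo d"])
              (auto simp: mem)
        qed
        show "k \<in> {\<lceil>c\<rceil>..\<lfloor>d\<rfloor>}" using k by (auto simp: le_floor_iff ceiling_le_iff)
      qed (use True gL wide in auto)
      then show ?thesis using le unfolding inner card_SigmaI[OF finite_atLeastAtMost_int ballI[OF finN']] of_nat_sum
        by linarith
    next
      case False
      have "1 - 1 / L - 2 / g m \<le> 0"
      proof (cases "2 \<le> g m")
        case True
        then have "L = 2" "g m = 2" using False gL wide by auto
        then show ?thesis by simp
      next
        case False
        then have "1 \<le> 2 / g m" using P.peak_pos by simp
        moreover have "0 \<le> 1 / L" using L by simp
        ultimately show ?thesis by linarith
      qed
      then have "measure lborel S * (1 - 1 / L - 2 / g m) \<le> 0" using V0 by (rule mult_nonneg_nonpos[rotated])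
      then show ?thesis using le by linarith
    qed
  qed
qed

section \<open>Successive minima and reduced bases\<close>

lemma integer_lattice_iff: "x \<in> integer_lattice \<longleftrightarrow> x $ 1 \<in> \<int> \<and> x $ 2 \<in> \<int>"
  by (simp add: integer_lattice_def forall_2)

lemma finite_bounded_integer_lattice:
  assumes "bounded B"
  shows "finite (B \<inter> integer_lattice)"
proof -
  obtain R where R: "\<And>x. x \<in> B \<Longrightarrow> norm x \<le> R" using assms by (auto simp: bounded_iff)
  define J :: "real set" where "J = of_int ` {- \<lceil>R\<rceil>..\<lceil>R\<rceil>}"
  have J: "y \<in> J" if y: "y \<in> \<int>" "\<bar>y\<bar> \<le> R" for y
  proof -
    obtain k where k: "y = of_int k" using y(1) by (rule Ints_cases)
    then have "k \<in> {- \<lceil>R\<rceil>..\<lceil>R\<rceil>}" using y(2) by (auto simp: k) linarith+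
    then show ?thesis unfolding J_def k by blast
  qed
  have "B \<inter> integer_lattice \<subseteq> (\<lambda>(a, b). vector [a, b]) ` (J \<times> J)"
  proof
    fix x assume x: "x \<in> B \<inter> integer_lattice"
    then have "x $ 1 \<in> J" "x $ 2 \<in> J"
      using J R[of x] component_le_norm_cart[of x] by (auto simp: integer_lattice_iff intro: order_trans)
    moreover have "x = (\<lambda>(a, b). vector [a, b]) (x $ 1, x $ 2)" by (simp add: vec_eq_iff forall_2)
    ultimately show "x \<in> (\<lambda>(a, b). vector [a, b]) ` (J \<times> J)" by blast
  qed
  moreover have "finite J" by (simp add: J_def)
  ultimately show ?thesis by (meson finite_SigmaI finite_imageI finite_subset)
qed

section \<open>Planar determinants and the symmetrised body\<close>

definition det2 :: "real ^ 2 \<Rightarrow> real ^ 2 \<Rightarrow> real" where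
  "det2 u v = u $ 1 * v $ 2 - u $ 2 * v $ 1"

lemma det2_zeroD:
  assumes "det2 u z = 0" "u \<noteq> 0"
  shows "z \<in> span {u}"
proof -
  have e: "u $ 1 * z $ 2 = u $ 2 * z $ 1" using assms(1) by (simp add: det2_def)
  show ?thesis
  proof (cases "u $ 1 = 0")
    case True
    then have "u $ 2 \<noteq> 0" using assms(2) by (auto simp: vec_eq_iff forall_2)
    then have "z = (z $ 2 / u $ 2) *\<^sub>R u" using e True by (simp add: vec_eq_iff forall_2)
    then show ?thesis by (metis span_breakdown_eq span_clauses(4) span_base singletonI)
  next
    case False
    then have "z = (z $ 1 / u $ 1) *\<^sub>R u" using e by (simp add: vec_eq_iff forall_2 field_simps)
    then show ?thesis by (metis span_clauses(4) span_base singletonI)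
  qed
qed

lemma det2_independent:
  assumes "det2 u v \<noteq> 0"
  shows "independent {u, v}" "card {u, v} = 2"
proof -
  have u: "u \<noteq> 0" "u \<noteq> v" using assms by (auto simp: det2_def)
  have "v \<notin> span {u}" using assms by (auto simp: det2_def span_singleton)
  then show "independent {u, v}" using u by (simp add: independent_insert insert_commute[of u v])
  show "card {u, v} = 2" using u by simp
qed

lemma
  assumes "K \<in> convex_bodies"
  shows central_sym_compact: "compact (central_sym K)"
    and central_sym_convex: "convex (central_sym K)"
    and central_sym_uminus: "x \<in> central_sym K \<Longrightarrow> - x \<in> central_sym K"
    and central_sym_ball: "\<exists>r>0. ball 0 r \<subseteq> central_sym K"
proof -
  have K: "compact K" "convex K" "interior K \<noteq> {}" using assms by (auto simp: convex_bodies_def)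
  define f where "f = (\<lambda>p :: (real ^ 2) \<times> (real ^ 2). (1/2) *\<^sub>R (fst p - snd p))"
  have C: "central_sym K = f ` (K \<times> K)" unfolding central_sym_def f_def by force
  have "linear f" unfolding f_def
    by (intro linearI) (auto simp: algebra_simps)
  then show "convex (central_sym K)" unfolding C using K by (intro convex_linear_image convex_Times)
  show "compact (central_sym K)" unfolding C f_def using K
    by (intro compact_continuous_image compact_Times continuous_intros)
  show "- x \<in> central_sym K" if "x \<in> central_sym K"
  proof -
    obtain p q where pq: "p \<in> K" "q \<in> K" "x = (1/2) *\<^sub>R (p - q)" using \<open>x \<in> central_sym K\<close> by (auto simp: central_sym_def)
    then have "- x = (1/2) *\<^sub>R (q - p)" by (simp add: algebra_simps)
    then show ?thesis using pq by (auto simp: central_sym_def)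
  qed
  obtain a r where r: "0 < r" "ball a r \<subseteq> K" using K(3) by (meson ex_in_conv mem_interior)
  have "z \<in> central_sym K" if "norm z < r" for z
  proof -
    have "a + z \<in> K" "a - z \<in> K" using that r(2) by (auto intro!: subsetD[OF r(2)] simp: dist_norm)
    moreover have "z = (1/2) *\<^sub>R ((a + z) - (a - z))"
      by (simp add: vec_eq_iff)
    ultimately show ?thesis unfolding central_sym_def by blast
  qed
  then show "\<exists>r>0. ball 0 r \<subseteq> central_sym K" using r(1) by (auto simp: subset_iff)
qed

section \<open>Lattice minima of a symmetric body\<close>

locale symmetric_body =
  fixes C :: "(real ^ 2) set"
  assumes cpt: "compact C" and cvx: "convex C" and sym: "x \<in> C \<Longrightarrow> - x \<in> C"
    and ball: "\<exists>r>0. ball 0 r \<subseteq> C"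
begin

lemma zero_mem: "0 \<in> C"
  using ball by auto

lemma scale_mem:
  assumes "x \<in> C" "0 \<le> t" "t \<le> 1"
  shows "t *\<^sub>R x \<in> C"
  using convexD[OF cvx assms(1) zero_mem, of t "1 - t"] assms by simp

text \<open>After moving signs into the points, dividing by \<open>s\<close> gives a convex
  combination, and scaling back by \<open>s \<le> 1\<close> stays in \<open>C\<close>.\<close>

lemma abs_convex_mem:
  assumes "x \<in> C" "y \<in> C" "\<bar>a\<bar> + \<bar>b\<bar> \<le> 1"
  shows "a *\<^sub>R x + b *\<^sub>R y \<in> C"
proof -
  define s where "s = \<bar>a\<bar> + \<bar>b\<bar>"
  define x' y' where "x' = (if 0 \<le> a then x else - x)" and "y' = (if 0 \<le> b then y else - y)"
  have xy: "x' \<in> C" "y' \<in> C" "a *\<^sub>R x = \<bar>a\<bar> *\<^sub>R x'" "b *\<^sub>R y = \<bar>b\<bar> *\<^sub>R y'"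
    using assms sym by (auto simp: x'_def y'_def)
  show ?thesis
  proof (cases "s = 0")
    case True
    then have "a = 0" "b = 0" by (simp_all add: s_def)
    then show ?thesis using zero_mem by simp
  next
    case False
    then have s: "0 < s" unfolding s_def by linarith
    have "(\<bar>a\<bar> / s) *\<^sub>R x' + (\<bar>b\<bar> / s) *\<^sub>R y' \<in> C"
      using s by (intro convexD[OF cvx] xy) (auto simp: s_def simp flip: add_divide_distrib)
    then have "s *\<^sub>R ((\<bar>a\<bar> / s) *\<^sub>R x' + (\<bar>b\<bar> / s) *\<^sub>R y') \<in> C"
      using assms(3) s by (intro scale_mem) (auto simp: s_def)
    then show ?thesis unfolding xy(3,4) using s by (simp add: scaleR_add_right)
  qed
qed

text \<open>The reach of \<open>z\<close> is the largest \<open>t\<close> with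
  \<open>t *\<^sub>R z \<in> C\<close>, the reciprocal of its gauge. Only finitely many vectors
  reach a given \<open>t0 > 0\<close>, and for each of them the admissible factors from
  \<open>t0\<close> on form a compact set, so a maximum is attained.\<close>

lemma maximal_reach:
  assumes P: "P \<subseteq> integer_lattice" "0 \<notin> P" "P \<noteq> {}"
  obtains u t where "u \<in> P" "0 < t" "t *\<^sub>R u \<in> C"
    and "\<And>z s. z \<in> P \<Longrightarrow> s *\<^sub>R z \<in> C \<Longrightarrow> s \<le> t"
proof -
  obtain r where r: "0 < r" "ball 0 r \<subseteq> C" using ball by blast
  obtain z0 where z0: "z0 \<in> P" "z0 \<noteq> 0" using P by auto
  define t0 where "t0 = r / (2 * norm z0)"
  have t0: "0 < t0" using r z0 by (simp add: t0_def)
  have t0z: "t0 *\<^sub>R z0 \<in> C" using r z0 by (intro subsetD[OF r(2)]) (simp add: t0_def)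
  define Q where "Q = {z \<in> P. t0 *\<^sub>R z \<in> C}"
  have cpt_scale: "compact ((\<lambda>x. (1/t) *\<^sub>R x) ` C)" for t :: real by (rule compact_scaling[OF cpt])
  have "Q \<subseteq> ((\<lambda>x. (1/t0) *\<^sub>R x) ` C) \<inter> integer_lattice"
  proof
    fix z assume z: "z \<in> Q"
    then have "z = (1/t0) *\<^sub>R (t0 *\<^sub>R z)" using t0 by simp
    then show "z \<in> ((\<lambda>x. (1/t0) *\<^sub>R x) ` C) \<inter> integer_lattice" using z P(1) unfolding Q_def by blast
  qed
  then have finQ: "finite Q"
    using finite_bounded_integer_lattice[OF compact_imp_bounded[OF cpt_scale]] finite_subset by blast
  define T where "T z = {t. t0 \<le> t \<and> t *\<^sub>R z \<in> C}" for z
  have cT: "compact (T z)" if "z \<in> Q" for z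
  proof -
    have z: "z \<noteq> 0" using that P by (auto simp: Q_def)
    obtain R where R: "\<And>x. x \<in> C \<Longrightarrow> norm x \<le> R"
      using compact_imp_bounded[OF cpt] by (auto simp: bounded_iff)
    have "T z \<subseteq> {t0..R / norm z}" using R[of "_ *\<^sub>R z"] z t0 by (fastforce simp: T_def field_simps)
    then have "bounded (T z)" using bounded_closed_interval bounded_subset by metis
    moreover have "closed ({t0..} \<inter> ((\<lambda>t. t *\<^sub>R z) -` C))"
      using compact_imp_closed[OF cpt] by (intro closed_Int closed_vimage continuous_intros closed_atLeast)
    moreover have "T z = {t0..} \<inter> ((\<lambda>t. t *\<^sub>R z) -` C)" by (auto simp: T_def)
    ultimately show ?thesis by (simp add: compact_eq_bounded_closed)
  qed
  have "compact (\<Union>z\<in>Q. T z)" using finQ cT by (rule compact_UN)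
  moreover have "t0 \<in> (\<Union>z\<in>Q. T z)" using z0 t0z by (auto simp: Q_def T_def)
  ultimately obtain t where t: "t \<in> (\<Union>z\<in>Q. T z)" "\<And>s. s \<in> (\<Union>z\<in>Q. T z) \<Longrightarrow> s \<le> t"
    using compact_attains_sup by (metis empty_iff)
  then obtain u where u: "u \<in> Q" "t0 \<le> t" "t *\<^sub>R u \<in> C" by (auto simp: T_def)
  have "s \<le> t" if z: "z \<in> P" "s *\<^sub>R z \<in> C" for z s
  proof (cases "t0 \<le> s")
    case True
    then have "(t0 / s) *\<^sub>R (s *\<^sub>R z) \<in> C" using z(2) t0 by (intro scale_mem[OF z(2)]) auto
    then have "z \<in> Q" using True t0 z by (simp add: Q_def)
    then show ?thesis using True z by (intro t(2)) (auto simp: T_def)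
  next
    case False
    then show ?thesis using u by simp
  qed
  then show ?thesis using that[of u t] u t0 by (auto simp: Q_def)
qed

lemma mem_scaled_iff: "0 < l \<Longrightarrow> x \<in> (\<lambda>x. l *\<^sub>R x) ` C \<longleftrightarrow> (1 / l) *\<^sub>R x \<in> C"
  by (auto simp: image_iff) (metis divide_inverse_commute mult.right_neutral scaleR_one
      scaleR_scaleR right_inverse less_irrefl)

lemma successive_min_sym_1:
  assumes "u \<in> integer_lattice" "u \<noteq> 0" "0 < t" "t *\<^sub>R u \<in> C"
    and max: "\<And>z s. z \<in> integer_lattice - {0} \<Longrightarrow> s *\<^sub>R z \<in> C \<Longrightarrow> s \<le> t"
  shows "successive_min_sym 1 C = 1 / t"
  unfolding successive_min_sym_def
proof (rule Least_equality)
  have "u \<in> (\<lambda>x. (1 / t) *\<^sub>R x) ` C \<inter> integer_lattice"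
    using assms by (subst Int_iff, subst mem_scaled_iff) auto
  then have "card {u} \<le> dim ((\<lambda>x. (1 / t) *\<^sub>R x) ` C \<inter> integer_lattice)"
    using assms by (intro independent_card_le_dim) auto
  then show "0 < 1 / t \<and> 1 \<le> dim ((\<lambda>x. (1 / t) *\<^sub>R x) ` C \<inter> integer_lattice)"
    using assms by simp
next
  fix l :: real assume l: "0 < l \<and> 1 \<le> dim ((\<lambda>x. l *\<^sub>R x) ` C \<inter> integer_lattice)"
  then have "\<not> (\<lambda>x. l *\<^sub>R x) ` C \<inter> integer_lattice \<subseteq> {0}"
    using dim_eq_0[of "(\<lambda>x. l *\<^sub>R x) ` C \<inter> integer_lattice"] by (metis not_one_le_zero)
  then obtain z where z: "z \<in> (\<lambda>x. l *\<^sub>R x) ` C" "z \<in> integer_lattice" "z \<noteq> 0" by auto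
  then have "1 / l \<le> t" using l mem_scaled_iff[of l z] by (intro max[of z]) auto
  then show "1 / t \<le> l" using l assms by (simp add: field_simps)
qed

text \<open>A dilate contains two independent lattice points only if one of them lies off the line
  of \<open>u\<close>, and such points have reach at most \<open>t\<close>. Conversely the dilate by
  \<open>1 / t\<close> contains \<open>u\<close> and \<open>v\<close>.\<close>

lemma successive_min_sym_2:
  assumes u: "u \<in> integer_lattice" "u \<noteq> 0" "t *\<^sub>R u \<in> C"
    and v: "v \<in> integer_lattice" "det2 u v \<noteq> 0" "0 < t" "t *\<^sub>R v \<in> C"
    and max: "\<And>z s. z \<in> integer_lattice \<Longrightarrow> det2 u z \<noteq> 0 \<Longrightarrow> s *\<^sub>R z \<in> C \<Longrightarrow> s \<le> t"
  shows "successive_min_sym 2 C = 1 / t"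
  unfolding successive_min_sym_def
proof (rule Least_equality)
  have "u \<in> (\<lambda>x. (1 / t) *\<^sub>R x) ` C" "v \<in> (\<lambda>x. (1 / t) *\<^sub>R x) ` C"
    using assms by (simp_all add: mem_scaled_iff)
  then have "card {u, v} \<le> dim ((\<lambda>x. (1 / t) *\<^sub>R x) ` C \<inter> integer_lattice)"
    using assms det2_independent(1)[OF v(2)] by (intro independent_card_le_dim) auto
  then show "0 < 1 / t \<and> 2 \<le> dim ((\<lambda>x. (1 / t) *\<^sub>R x) ` C \<inter> integer_lattice)"
    unfolding det2_independent(2)[OF v(2)] using v by simp
next
  fix l :: real assume l: "0 < l \<and> 2 \<le> dim ((\<lambda>x. l *\<^sub>R x) ` C \<inter> integer_lattice)"
  then have "\<not> (\<lambda>x. l *\<^sub>R x) ` C \<inter> integer_lattice \<subseteq> span {u}"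
    using dim_le_card[of "(\<lambda>x. l *\<^sub>R x) ` C \<inter> integer_lattice" "{u}"] by auto
  then obtain z where z: "z \<in> (\<lambda>x. l *\<^sub>R x) ` C" "z \<in> integer_lattice" "det2 u z \<noteq> 0"
    using det2_zeroD u(2) by blast
  then have "1 / l \<le> t" using l mem_scaled_iff[of l z] by (intro max[of z]) auto
  then show "1 / t \<le> l" using l v by (simp add: field_simps)
qed

text \<open>If vectors \<open>u\<close>, \<open>v\<close> attaining the minima span a sublattice of index \<open>D \<ge> 2\<close>, then some
  \<open>v' = (v - r u) / D\<close> with \<open>2 |r| \<le> D\<close> completes \<open>u\<close> to a basis. Since \<open>1 / D + |r| / D \<le> 1\<close>, it
  is no longer than \<open>v\<close>.\<close>

lemma reduced_basis:
  obtains u v s t where "u \<in> integer_lattice" "v \<in> integer_lattice" "det2 u v = 1"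
    and "0 < s" "0 < t" "s *\<^sub>R u \<in> C" "t *\<^sub>R v \<in> C"
    and "\<And>z r. z \<in> integer_lattice - {0} \<Longrightarrow> r *\<^sub>R z \<in> C \<Longrightarrow> r \<le> s"
    and "successive_min_sym 1 C = 1 / s" "successive_min_sym 2 C = 1 / t"
proof -
  have "vector [1, 0] \<in> integer_lattice - {0 :: real ^ 2}"
    by (auto simp: integer_lattice_iff vec_eq_iff forall_2)
  then obtain u s where u: "u \<in> integer_lattice" "u \<noteq> 0" "0 < s" "s *\<^sub>R u \<in> C"
    and s: "\<And>z r. z \<in> integer_lattice - {0} \<Longrightarrow> r *\<^sub>R z \<in> C \<Longrightarrow> r \<le> s"
    using maximal_reach[of "integer_lattice - {0}"] by (metis Diff_iff Diff_subset empty_iff insertI1)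
  \<comment> \<open>Lattice vectors off the line of \<open>u\<close>; turning \<open>u\<close> by a
    right angle gives one.\<close>
  define P where "P = {z \<in> integer_lattice. det2 u z \<noteq> 0}"
  have "0 < u $ 1 * u $ 1 + u $ 2 * u $ 2"
    using u(2) by (auto simp: vec_eq_iff forall_2 sum_squares_gt_zero_iff)
  then have "vector [- u $ 2, u $ 1] \<in> P"
    using u by (auto simp: P_def integer_lattice_iff det2_def)
  moreover have "P \<subseteq> integer_lattice" "0 \<notin> P" by (auto simp: P_def det2_def)
  ultimately obtain w t where w0: "w \<in> P" "0 < t" "t *\<^sub>R w \<in> C"
    and t: "\<And>z r. z \<in> P \<Longrightarrow> r *\<^sub>R z \<in> C \<Longrightarrow> r \<le> t"
    using maximal_reach[of P] \<open>P \<subseteq> integer_lattice\<close> \<open>0 \<notin> P\<close> by (metis empty_iff)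
  obtain v where v: "v \<in> integer_lattice" "0 < det2 u v" "t *\<^sub>R v \<in> C"
  proof (cases "0 < det2 u w")
    case True
    then show ?thesis using that[of w] w0 by (simp add: P_def)
  next
    case False
    then show ?thesis using that[of "- w"] w0 sym by (auto simp: P_def det2_def integer_lattice_iff)
  qed
  have "w \<noteq> 0" using w0 by (auto simp: P_def det2_def)
  then have ts: "t \<le> s" using s[of w t] w0 by (auto simp: P_def)
  have tu: "t *\<^sub>R u \<in> C" using scale_mem[OF u(4), of "t / s"] ts u(3) w0(2) by simp
  have min1: "successive_min_sym 1 C = 1 / s" using successive_min_sym_1 u s by blast
  have min2: "successive_min_sym 2 C = 1 / t"
    using successive_min_sym_2[OF u(1,2) tu v(1) _ w0(2) v(3)] v(2) t by (simp add: P_def)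
  obtain a b where ab: "u $ 1 = of_int a" "u $ 2 = of_int b"
    using u(1) by (auto simp: integer_lattice_iff elim!: Ints_cases)
  \<comment> \<open>\<open>u\<close> is primitive: dividing out a common divisor would give a
    nonzero lattice vector of reach at least \<open>2 * s\<close>.\<close>
  have gcd: "gcd a b = 1"
  proof (rule ccontr)
    assume g: "gcd a b \<noteq> 1"
    have "a \<noteq> 0 \<or> b \<noteq> 0" using ab u(2) by (auto simp: vec_eq_iff forall_2)
    then have g2: "2 \<le> gcd a b" using g gcd_pos_int[of a b] by linarith
    obtain a' b' where a': "a = gcd a b * a'" "b = gcd a b * b'" by (meson dvdE gcd_dvd1 gcd_dvd2)
    define z :: "real ^ 2" where "z = vector [of_int a', of_int b']"
    have "real_of_int a = of_int (gcd a b) * of_int a'" "real_of_int b = of_int (gcd a b) * of_int b'"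
      using a' by (metis of_int_mult)+
    then have uz: "u = of_int (gcd a b) *\<^sub>R z" unfolding z_def by (simp add: vec_eq_iff forall_2 ab)
    then have "z \<in> integer_lattice - {0}" using u(2) by (auto simp: z_def integer_lattice_iff)
    moreover have "(s * of_int (gcd a b)) *\<^sub>R z \<in> C" using u(4) by (subst (asm) uz) simp
    ultimately have "s * of_int (gcd a b) \<le> s" by (rule s)
    moreover have "s * 2 \<le> s * of_int (gcd a b)" using g2 u(3) by (intro mult_left_mono) auto
    ultimately show False using u(3) by simp
  qed
  obtain x y where xy: "x * a + y * b = 1" using bezout_int[of a b] gcd by auto
  define v0 :: "real ^ 2" where "v0 = vector [- of_int y, of_int x]"
  have v0: "det2 u v0 = 1"
  proof -
    have "det2 u v0 = of_int (x * a + y * b)" by (simp add: det2_def v0_def ab mult.commute)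
    then show ?thesis using xy by simp
  qed
  obtain e f where ef: "v $ 1 = of_int e" "v $ 2 = of_int f"
    using v(1) by (auto simp: integer_lattice_iff elim!: Ints_cases)
  \<comment> \<open>Coordinates in the basis \<open>u\<close>, \<open>v0\<close> obtained from
    Bezout: \<open>v\<close> equals \<open>X\<close> times \<open>u\<close> plus \<open>D\<close>
    times \<open>v0\<close>.\<close>
  define D X where "D = a * f - b * e" and "X = e * x + f * y"
  have D: "det2 u v = of_int D" by (simp add: D_def det2_def ab ef)
  have D0: "0 < D" using v(2) D by simp
  \<comment> \<open>The integer nearest to \<open>X / D\<close>, so the remainder \<open>r\<close>
    has \<open>2 * \<bar>r\<bar> \<le> D\<close>; integrality gives
    \<open>1 + \<bar>r\<bar> \<le> D\<close> also for \<open>D = 1\<close>.\<close>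
  define k where "k = (2 * X + D) div (2 * D)"
  define r where "r = X - k * D"
  have "2 * r = (2 * X + D) mod (2 * D) - D"
    using div_mult_mod_eq[of "2 * X + D" "2 * D"] by (simp add: r_def k_def algebra_simps)
  moreover have "0 \<le> (2 * X + D) mod (2 * D)" "(2 * X + D) mod (2 * D) < 2 * D" using D0 by auto
  ultimately have r: "1 + \<bar>r\<bar> \<le> D" by linarith
  define v' where "v' = v0 + of_int k *\<^sub>R u"
  have det': "det2 u v' = 1" using v0 by (simp add: v'_def det2_def algebra_simps)
  have "of_int D *\<^sub>R v' = v - of_int r *\<^sub>R u"
  proof -
    have "e = X * a - D * y" "f = X * b + D * x"
      using xy unfolding D_def X_def by algebra+
    then have "real_of_int e = of_int X * of_int a - of_int D * of_int y"
      "real_of_int f = of_int X * of_int b + of_int D * of_int x" by (metis of_int_mult of_int_diff of_int_add)+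
    then show ?thesis
      by (simp add: v'_def v0_def r_def vec_eq_iff forall_2 ab ef algebra_simps)
  qed
  then have v'_eq: "v' = (1 / of_int D) *\<^sub>R (v - of_int r *\<^sub>R u)"
    using D0 by (metis divide_inverse_commute inverse_eq_divide mult.right_neutral less_irrefl of_int_0_eq_iff real_vector_eq_affinity scaleR_one scaleR_scaleR divide_self)
  have "t *\<^sub>R v' = (1 / of_int D) *\<^sub>R (t *\<^sub>R v) + (- of_int r / of_int D) *\<^sub>R (t *\<^sub>R u)"
    unfolding v'_eq by (simp add: scaleR_diff_right mult.commute)
  moreover have "(1 / of_int D) *\<^sub>R (t *\<^sub>R v) + (- of_int r / of_int D) *\<^sub>R (t *\<^sub>R u) \<in> C"
  proof (rule abs_convex_mem[OF v(3) tu])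
    have "(1 + \<bar>of_int r\<bar>) / of_int D \<le> (1::real)" using r D0 by (simp add: divide_le_eq_1)
    then show "\<bar>1 / of_int D\<bar> + \<bar>- of_int r / of_int D\<bar> \<le> (1::real)" using D0 by (simp add: add_divide_distrib)
  qed
  ultimately have "t *\<^sub>R v' \<in> C" by simp
  moreover have "v' \<in> integer_lattice" by (simp add: v'_def v0_def integer_lattice_iff ab)
  ultimately show ?thesis using that[of u v' s t] u det' w0(2) s min1 min2 by blast
qed

end

section \<open>Unimodular change of coordinates\<close>

text \<open>Slicing takes place in pairs of reals while the bodies live in \<open>real ^ 2\<close>;
  a measure that agrees with Lebesgue measure on boxes equals it.\<close>

lemma distr_lborel_vector: "distr lborel borel (\<lambda>p :: real \<times> real. vector [fst p, snd p] :: real ^ 2) = lborel"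
proof (rule lborel_eqI[symmetric])
  let ?f = "\<lambda>p :: real \<times> real. vector [fst p, snd p] :: real ^ 2"
  have f: "?f = (\<lambda>p. fst p *\<^sub>R axis 1 1 + snd p *\<^sub>R axis 2 1)"
    by (simp add: fun_eq_iff vec_eq_iff forall_2 axis_def)
  have f_meas: "?f \<in> borel_measurable borel"
    unfolding f by (intro borel_measurable_continuous_onI continuous_intros)
  fix l u :: "real ^ 2" assume lu: "\<And>b. b \<in> Basis \<Longrightarrow> l \<bullet> b \<le> u \<bullet> b"
  have le: "l $ i \<le> u $ i" for i using lu[of "axis i 1"] by (simp add: inner_axis)
  have "?f -` box l u = {l $ 1 <..< u $ 1} \<times> {l $ 2 <..< u $ 2}"
    by (auto simp: mem_box_cart forall_2)
  then have "emeasure (distr lborel borel ?f) (box l u)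
      = emeasure (lborel \<Otimes>\<^sub>M lborel) ({l $ 1 <..< u $ 1} \<times> {l $ 2 <..< u $ 2})"
    using f_meas by (simp add: emeasure_distr lborel_prod)
  also have "\<dots> = ennreal (u $ 1 - l $ 1) * ennreal (u $ 2 - l $ 2)"
    using le by (subst lborel.emeasure_pair_measure_Times) auto
  also have "\<dots> = ennreal (\<Prod>b\<in>Basis. (u - l) \<bullet> b)"
  proof -
    have B: "Basis = {axis 1 1, axis 2 1 :: real ^ 2}"
      by (auto simp: Basis_vec_def UNIV_2)
    moreover have "axis 1 1 \<noteq> (axis 2 1 :: real ^ 2)" by (simp add: axis_eq_axis)
    ultimately show ?thesis using le unfolding B by (simp add: inner_axis ennreal_mult)
  qed
  finally show "emeasure (distr lborel borel ?f) (box l u) = ennreal (\<Prod>b\<in>Basis. (u - l) \<bullet> b)" .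
qed simp

text \<open>The map is the identification of pairs with vectors followed by the linear map with
  columns \<open>u\<close> and \<open>v\<close>, of determinant 1.\<close>

lemma measure_unimodular_image:
  fixes S :: "(real \<times> real) set" and u v :: "real ^ 2"
  assumes "compact S" "det2 u v = 1"
  shows "measure lebesgue ((\<lambda>p. fst p *\<^sub>R u + snd p *\<^sub>R v) ` S) = measure lborel S"
proof -
  define f where "f = (\<lambda>p :: real \<times> real. vector [fst p, snd p] :: real ^ 2)"
  define A where "A = (\<lambda>z :: real ^ 2. z $ 1 *\<^sub>R u + z $ 2 *\<^sub>R v)"
  have f: "f = (\<lambda>p. fst p *\<^sub>R axis 1 1 + snd p *\<^sub>R axis 2 1)"
    by (simp add: f_def fun_eq_iff vec_eq_iff forall_2 axis_def)
  have cont: "continuous_on X f" for X unfolding f by (intro continuous_intros)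
  have fS: "compact (f ` S)" by (rule compact_continuous_image[OF cont assms(1)])
  have inj: "f -` (f ` S) = S"
    unfolding f_def by (auto simp: vec_eq_iff forall_2)
  have A: "linear A" unfolding A_def by (intro linearI) (auto simp: algebra_simps)
  have "det (matrix A) = 1"
    using assms(2) by (simp add: det_2 matrix_def A_def axis_def det2_def mult.commute)
  then have "measure lebesgue (A ` (f ` S)) = measure lebesgue (f ` S)"
    using measure_linear_image[OF A] fS by (simp add: lmeasurable_compact)
  also have "\<dots> = measure lborel (f ` S)"
    using fS by (simp add: borel_compact measure_completion)
  also have "\<dots> = measure (distr lborel borel f) (f ` S)"
    using distr_lborel_vector by (simp add: f_def)
  also have "\<dots> = measure lborel S"
    using fS inj borel_measurable_continuous_onI[OF cont[of UNIV]]
    by (subst measure_distr) (auto simp: borel_compact)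
  also have "A ` (f ` S) = (\<lambda>p. fst p *\<^sub>R u + snd p *\<^sub>R v) ` S"
    by (auto simp: image_image A_def f_def)
  finally show ?thesis .
qed

theorem theorem1p4:
  fixes K :: "(real ^ 2) set"
  assumes "K \<in> convex_bodies"
  shows "real (lattice_count K)
           \<le> measure lebesgue K * (1 + successive_min 1 K / 2) * (1 + successive_min 2 K)
       \<and> real (lattice_count (interior K))
           \<ge> measure lebesgue K * (1 - successive_min 1 K / 2 - successive_min 2 K)"
proof -
  have K: "compact K" "convex K" "interior K \<noteq> {}" using assms by (auto simp: convex_bodies_def)
  interpret symmetric_body "central_sym K"
    using central_sym_compact central_sym_convex central_sym_uminus central_sym_ball assms
    by unfold_locales auto
  obtain u v s t where uv: "u \<in> integer_lattice" "v \<in> integer_lattice" "det2 u v = 1"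
    and st: "0 < s" "0 < t" "s *\<^sub>R u \<in> central_sym K" "t *\<^sub>R v \<in> central_sym K"
    and max: "\<And>z r. z \<in> integer_lattice - {0} \<Longrightarrow> r *\<^sub>R z \<in> central_sym K \<Longrightarrow> r \<le> s"
    and minima: "successive_min 1 K = 1 / s" "successive_min 2 K = 1 / t"
    using reduced_basis unfolding successive_min_def by blast
  define f where "f = (\<lambda>p. fst p *\<^sub>R u + snd p *\<^sub>R v)"
  \<comment> \<open>Cramer's rule with determinant 1: \<open>h\<close> is the inverse of
    \<open>f\<close>.\<close>
  define h where "h = (\<lambda>z. (det2 z v, det2 u z))"
  have hf: "h (f p) = p" for p
  proof -
    have "det2 (f p) v = fst p * det2 u v" "det2 u (f p) = snd p * det2 u v"
      by (simp_all add: det2_def f_def algebra_simps)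
    then show ?thesis using uv(3) by (simp add: h_def prod_eq_iff)
  qed
  have fh: "f (h z) = z" for z
  proof -
    have "f (h z) = det2 u v *\<^sub>R z"
      by (simp add: det2_def f_def h_def vec_eq_iff forall_2 algebra_simps)
    then show ?thesis using uv(3) by simp
  qed
  have lin_h: "linear h" unfolding h_def
    by (intro linearI) (auto simp: det2_def algebra_simps)
  have lin_f: "linear f" unfolding f_def by (intro linearI) (auto simp: algebra_simps)
  have bij_f: "bij f" using hf fh by (intro bijI') metis+
  define S where "S = h ` K"
  have mem: "p \<in> S \<longleftrightarrow> f p \<in> K" for p unfolding S_def using hf fh by (metis imageE imageI)
  have fS: "f ` S = K" unfolding S_def by (simp add: image_image fh)
  have "continuous_on K h" unfolding h_def det2_def by (intro continuous_intros)
  then have S: "compact S" "convex S" unfolding S_def using K lin_h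
    by (simp_all add: compact_continuous_image convex_linear_image)
  have int: "interior K = f ` interior S"
    using interior_bijective_linear_image[OF lin_f bij_f, of S] fS by simp
  then have int_ne: "interior S \<noteq> {}" using K(3) by auto
  have vol: "measure lebesgue K = measure lborel S"
    using measure_unimodular_image[OF S(1) uv(3)] fS by (simp add: f_def)

  \<comment> \<open>Membership of \<open>s *\<^sub>R u\<close> gives two points of \<open>K\<close>
    that differ by \<open>2 * s\<close> in the first coordinate only; likewise
    \<open>t *\<^sub>R v\<close> below gives a vertical chord of length
    \<open>2 * t\<close>.\<close>
  obtain p q where pq: "p \<in> K" "q \<in> K" "s *\<^sub>R u = (1/2) *\<^sub>R (p - q)"
    using st(3) by (auto simp: central_sym_def)
  have "f (fst (h q) + 2 * s, snd (h q)) = f (h q) + 2 *\<^sub>R (s *\<^sub>R u)"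
    by (simp add: f_def algebra_simps)
  then have "f (fst (h q) + 2 * s, snd (h q)) = p" unfolding pq(3) fh by simp
  then have width: "(fst (h q), snd (h q)) \<in> S" "(fst (h q) + 2 * s, snd (h q)) \<in> S"
    using pq by (simp_all add: mem fh)
  obtain a b where ab: "a \<in> K" "b \<in> K" "t *\<^sub>R v = (1/2) *\<^sub>R (a - b)"
    using st(4) by (auto simp: central_sym_def)
  have "f (fst (h b), snd (h b) + 2 * t) = f (h b) + 2 *\<^sub>R (t *\<^sub>R v)"
    by (simp add: f_def algebra_simps)
  then have "f (fst (h b), snd (h b) + 2 * t) = a" unfolding ab(3) fh by simp
  then have chord: "(fst (h b), snd (h b)) \<in> S" "(fst (h b), snd (h b) + 2 * t) \<in> S"
    using ab by (simp_all add: mem fh)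
  have "v \<noteq> 0" using uv(3) by (auto simp: det2_def)
  \<comment> \<open>Half the difference of the chord's ends is a multiple of the nonzero lattice
    vector \<open>v\<close> in \<open>central_sym K\<close>, so the maximal reach \<open>s\<close>
    bounds it.\<close>
  have chord_le: "y' - y \<le> 2 * s" if "(x, y) \<in> S" "(x, y') \<in> S" for x y y'
  proof -
    have "f (x, y') - f (x, y) = (y' - y) *\<^sub>R v" by (simp add: f_def algebra_simps)
    then have "((y' - y) / 2) *\<^sub>R v = (1/2) *\<^sub>R (f (x, y') - f (x, y))" by simp
    then have "((y' - y) / 2) *\<^sub>R v \<in> central_sym K"
      using that unfolding mem central_sym_def by blast
    then have "(y' - y) / 2 \<le> s" using max[of v] uv \<open>v \<noteq> 0\<close> by blast
    then show ?thesis by simp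
  qed

  define Z where "Z = (\<lambda>(i :: int, j :: int). f (of_int i, of_int j))"
  have injZ: "inj_on Z X" for X
    unfolding Z_def by (rule inj_onI) (use bij_f in \<open>auto simp: bij_def dest: injD\<close>)
  \<comment> \<open>Since \<open>det2 u v = 1\<close>, the coordinates of a lattice point are
    determinants of integer vectors, hence integers.\<close>
  have "Z ` UNIV = integer_lattice"
  proof
    show "Z ` UNIV \<subseteq> integer_lattice" using uv by (auto simp: Z_def f_def integer_lattice_iff)
    show "integer_lattice \<subseteq> Z ` UNIV"
    proof
      fix z assume z: "z \<in> integer_lattice"
      then have "fst (h z) \<in> \<int>" "snd (h z) \<in> \<int>"
        using uv by (auto simp: h_def det2_def integer_lattice_iff)
      then obtain i j where "h z = (of_int i, of_int j)" by (metis Ints_cases prod.collapse)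
      then have "Z (i, j) = z" using fh[of z] by (simp add: Z_def)
      then show "z \<in> Z ` UNIV" by blast
    qed
  qed
  then have count: "lattice_count (f ` X) = card {(i :: int, j :: int). (of_int i, of_int j) \<in> X}" for X
  proof -
    have "f ` X \<inter> Z ` UNIV = Z ` {(i, j). (of_int i, of_int j) \<in> X}"
      unfolding Z_def using bij_f by (auto simp: bij_def dest: injD)
    then show ?thesis unfolding lattice_count_def \<open>Z ` UNIV = _\<close>[symmetric] by (simp add: card_image[OF injZ])
  qed
  have "0 < 2 * t" using st(2) by simp
  \<comment> \<open>With \<open>L = 2 * s\<close> and \<open>M = 2 * t\<close>, the quotient
    \<open>1 / L\<close> is half the first minimum and \<open>2 / M\<close> is the second.\<close>
  have "real (lattice_count K) \<le> measure lebesgue K * (1 + 1 / (2 * s)) * (1 + 2 / (2 * t))"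
    using planar_count_bounds(1)[OF S int_ne width chord \<open>0 < 2 * t\<close>] chord_le count[of S]
    unfolding fS vol by presburger
  moreover have "measure lebesgue K * (1 - 1 / (2 * s) - 2 / (2 * t)) \<le> real (lattice_count (interior K))"
    using planar_count_bounds(2)[OF S int_ne width chord \<open>0 < 2 * t\<close>] chord_le count[of "interior S"]
    unfolding int vol by presburger
  ultimately show ?thesis unfolding minima by (simp add: mult.commute)
qed

end
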